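(* Let $X=\mathbb{R}$ and let $T\colon X\to X$ be averaged. Let $x$ and $y$ be in $\mathbb{R}$. Then the sequence $(T^n x-T^n y)_{n\in\mathbb{N}}$ is convergent.
   Context: A nonexpansive map $T\colon X\to X$ (i.e. $\|Tx-Ty\|\le\|x-y\|$ for all $x,y\in X$) is averaged if there exist a nonexpansive operator $R\colon X\to X$ and a constant $\alpha\in\left]0,1\right[$ such that $T=(1-\alpha)\operatorname{Id}+\alpha R$. *)

theory Defs
  imports "HOL-Analysis.Analysis"
begin

definition nonexpansive :: "('a::real_normed_vector \<Rightarrow> 'a) \<Rightarrow> bool" where
  "nonexpansive T \<longleftrightarrow> (\<forall>x y. norm (T x - T y) \<le> norm (x - y))"

(* The first conjunct follows from the second; it is kept because averagedness is a notion
   for nonexpansive maps. *)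
definition averaged :: "('a::real_normed_vector \<Rightarrow> 'a) \<Rightarrow> bool" where
  "averaged T \<longleftrightarrow> nonexpansive T \<and>
     (\<exists>R \<alpha>. nonexpansive R \<and> 0 < \<alpha> \<and> \<alpha> < 1 \<and>
        T = (\<lambda>x. (1 - \<alpha>) *\<^sub>R x + \<alpha> *\<^sub>R R x))"

end

theory Submission
  imports Defs
begin

text \<open>
  The distances \<open>\<bar>T\<^sup>n x - T\<^sup>n y\<bar>\<close> decrease to some limit \<open>L\<close>. Averagedness with constant \<open>\<alpha>\<close>
  forces a difference that changes sign to shrink in modulus by the factor
  \<open>\<bar>1 - 2\<alpha>\<bar> < 1\<close>. If \<open>L > 0\<close> this can happen only finitely often, so the
  sign is eventually constant and the differences themselves converge.
\<close>

text \<open>For \<open>a > 0\<close>, the bound \<open>- a \<le> r\<close> puts the combination at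
  or above \<open>(1 - 2 * \<alpha>) * a\<close>, hence above or at
  \<open>- (\<bar>1 - 2 * \<alpha>\<bar> * a)\<close>. A nonpositive value would thus have too small
  a modulus for the third assumption.\<close>

lemma sgn_average_eq:
  fixes a r \<alpha> :: real
  assumes "\<bar>r\<bar> \<le> \<bar>a\<bar>" and "0 < \<alpha>"
    and "\<bar>1 - 2 * \<alpha>\<bar> * \<bar>a\<bar> < \<bar>(1 - \<alpha>) * a + \<alpha> * r\<bar>"
  shows "sgn ((1 - \<alpha>) * a + \<alpha> * r) = sgn a"
proof -
  have pos: "0 < (1 - \<alpha>) * u + \<alpha> * s"
    if "0 < u" "\<bar>s\<bar> \<le> u" "\<bar>1 - 2 * \<alpha>\<bar> * u < \<bar>(1 - \<alpha>) * u + \<alpha> * s\<bar>" for u s :: real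
  proof -
    have "\<alpha> * (- u) \<le> \<alpha> * s"
      using that assms(2) by (intro mult_left_mono) auto
    then have "(1 - 2 * \<alpha>) * u \<le> (1 - \<alpha>) * u + \<alpha> * s"
      by (simp add: algebra_simps)
    moreover have "- (\<bar>1 - 2 * \<alpha>\<bar> * u) \<le> (1 - 2 * \<alpha>) * u"
      using mult_right_mono[of "- \<bar>1 - 2 * \<alpha>\<bar>" "1 - 2 * \<alpha>" u] that(1) by simp
    ultimately show ?thesis
      using that(3) by linarith
  qed
  consider "a = 0" | "0 < a" | "a < 0" by linarith
  then show ?thesis
  proof cases
    case 1
    then show ?thesis using assms(1) by simp
  next
    case 2
    then show ?thesis using pos[of a r] assms by simp
  next
    case 3
    \<comment> \<open>The combination is odd in \<open>(a, r)\<close>, so negating both reduces this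
      case to \<open>pos\<close>.\<close>
    have eq: "(1 - \<alpha>) * (- a) + \<alpha> * (- r) = - ((1 - \<alpha>) * a + \<alpha> * r)"
      by (simp add: algebra_simps)
    have "0 < (1 - \<alpha>) * (- a) + \<alpha> * (- r)"
    proof (rule pos)
      show "\<bar>1 - 2 * \<alpha>\<bar> * (- a) < \<bar>(1 - \<alpha>) * (- a) + \<alpha> * (- r)\<bar>"
        unfolding eq using 3 assms(3) by simp
    qed (use 3 assms(1) in auto)
    then have "(1 - \<alpha>) * a + \<alpha> * r < 0"
      unfolding eq by simp
    then show ?thesis using 3 by simp
  qed
qed

text \<open>The assumption \<open>stable\<close> is the contrapositive form of: a change of sign
  shrinks the modulus at least by the factor \<open>c\<close>.\<close>

lemma convergent_if_sgn_stable:
  fixes d :: "nat \<Rightarrow> real" and c :: real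
  assumes dec: "\<And>n. \<bar>d (Suc n)\<bar> \<le> \<bar>d n\<bar>"
    and "c < 1"
    and stable: "\<And>n. c * \<bar>d n\<bar> < \<bar>d (Suc n)\<bar> \<Longrightarrow> sgn (d (Suc n)) = sgn (d n)"
  shows "convergent d"
proof -
  have decs: "decseq (\<lambda>n. \<bar>d n\<bar>)"
    using dec by (rule decseq_SucI)
  obtain L where L: "(\<lambda>n. \<bar>d n\<bar>) \<longlonglongrightarrow> L" and L_le: "\<And>n. L \<le> \<bar>d n\<bar>"
    using decseq_convergent[OF decs, of 0] by auto
  have "0 \<le> L"
    using LIMSEQ_le_const[OF L, of 0] by auto
  show ?thesis
  proof (cases "L = 0")
    case True
    then have "d \<longlonglongrightarrow> 0"
      using L tendsto_rabs_zero_iff by blast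
    then show ?thesis by (rule convergentI)
  next
    case False
    \<comment> \<open>Since \<open>c * L < L\<close> and no modulus falls below \<open>L\<close>,
      the premise of \<open>stable\<close> holds from some index \<open>N\<close> on.\<close>
    have "(\<lambda>n. c * \<bar>d n\<bar>) \<longlonglongrightarrow> c * L"
      by (intro tendsto_intros L)
    moreover have "c * L < L"
      using False \<open>0 \<le> L\<close> \<open>c < 1\<close> by simp
    ultimately have "\<forall>\<^sub>F n in sequentially. c * \<bar>d n\<bar> < L"
      by (rule order_tendstoD)
    then obtain N where N: "\<And>n. n \<ge> N \<Longrightarrow> c * \<bar>d n\<bar> < L"
      by (auto simp: eventually_sequentially)
    have "sgn (d n) = sgn (d N)" if "n \<ge> N" for n
      using that
    proof (induction n rule: dec_induct)
      case (step n)
      then show ?case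
        using stable[of n] N[of n] L_le[of "Suc n"] by simp
    qed simp
    \<comment> \<open>With its sign frozen, \<open>d\<close> is eventually a constant multiple of
      its convergent modulus.\<close>
    then have "\<forall>\<^sub>F n in sequentially. sgn (d N) * \<bar>d n\<bar> = d n"
      unfolding eventually_sequentially by (metis sgn_mult_abs)
    moreover have "(\<lambda>n. sgn (d N) * \<bar>d n\<bar>) \<longlonglongrightarrow> sgn (d N) * L"
      by (intro tendsto_intros L)
    ultimately have "d \<longlonglongrightarrow> sgn (d N) * L"
      by (rule Lim_transform_eventually[rotated])
    then show ?thesis by (rule convergentI)
  qed
qed

theorem theorem3p10:
  fixes T :: "real \<Rightarrow> real" and x y :: real
  assumes "averaged T"
  shows "convergent (\<lambda>n. (T ^^ n) x - (T ^^ n) y)"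
proof -
  obtain R \<alpha> where T_nonexp: "\<And>u v. \<bar>T u - T v\<bar> \<le> \<bar>u - v\<bar>"
    and R_nonexp: "\<And>u v. \<bar>R u - R v\<bar> \<le> \<bar>u - v\<bar>"
    and \<alpha>: "0 < \<alpha>" "\<alpha> < 1"
    and T_eq: "\<And>u. T u = (1 - \<alpha>) * u + \<alpha> * R u"
    using assms by (auto simp: averaged_def nonexpansive_def)
  \<comment> \<open>This is the combination in \<open>sgn_average_eq\<close> with
    \<open>a = u - v\<close> and \<open>r = R u - R v\<close>. It is used below with
    \<open>u\<close> and \<open>v\<close> the \<open>n\<close>-th iterates of \<open>x\<close> and
    \<open>y\<close>.\<close>
  have T_diff: "T u - T v = (1 - \<alpha>) * (u - v) + \<alpha> * (R u - R v)" for u v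
    by (simp add: T_eq algebra_simps)
  have sgn_T: "sgn (T u - T v) = sgn (u - v)"
    if "\<bar>1 - 2 * \<alpha>\<bar> * \<bar>u - v\<bar> < \<bar>T u - T v\<bar>" for u v
    using sgn_average_eq[OF R_nonexp \<alpha>(1)] that unfolding T_diff by blast
  show ?thesis
  proof (rule convergent_if_sgn_stable[where c = "\<bar>1 - 2 * \<alpha>\<bar>"])
    show "\<bar>1 - 2 * \<alpha>\<bar> < 1"
      using \<alpha> by linarith
  qed (simp_all add: T_nonexp sgn_T)
qed

end
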